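(* Let $m,n\in\mathbb{N}$ and let $L$ be any one of the logics $\mathbf{NA}_{m,n}$, $\mathbf{N}^+\mathbf{A}_{m,n}$, $\mathbf{NRA}_{m,n}$. Then $L$ enjoys the uniform Lyndon interpolation property (ULIP).
   Context: $\mathbb{N}$ includes $0$. Fix a countably infinite set $\mathrm{PropVar}$ of propositional variables. $\mathscr{L}_\Box$ is the set of formulas built from $\mathrm{PropVar}$ with $\land,\lor,\to,\bot,\Box$; $\top:=\bot\to\bot$, $\neg\varphi:=\varphi\to\bot$; $\Box^0\varphi:=\varphi$, $\Box^{k+1}\varphi:=\Box\Box^k\varphi$. Logics. $\mathbf{N}$ is classical propositional logic (tautologies in the language $\mathscr{L}_\Box$, modus ponens) plus the rule Nec: from $\varphi$ infer $\Box\varphi$. $\mathbf{NA}_{m,n}$ is $\mathbf{N}$ plus the axiom schema $\Box^n\varphi\to\Box^m\varphi$. $\mathbf{N}^+\mathbf{A}_{m,n}$ is $\mathbf{NA}_{m,n}$ plus the rule: from $\neg\Box\varphi$ infer $\neg\Box\Box\varphi$. $\mathbf{NRA}_{m,n}$ is $\mathbf{NA}_{m,n}$ plus the rule: from $\neg\varphi$ infer $\neg\Box\varphi$. (Rules apply to theorems; $L\vdash\varphi$ means $\varphi$ is a theorem of $L$.) Positive and negative variables. $\mathrm{V}^+(p)=\{p\}$, $\mathrm{V}^-(p)=\mathrm{V}^+(\bot)=\mathrm{V}^-(\bot)=\emptyset$; $\mathrm{V}^\bullet(\psi_1\to\psi_2)=\mathrm{V}^\circ(\psi_1)\cup\mathrm{V}^\bullet(\psi_2)$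 for $(\bullet,\circ)\in\{(+,-),(-,+)\}$; $\mathrm{V}^\bullet(\psi_1\land\psi_2)=\mathrm{V}^\bullet(\psi_1\lor\psi_2)=\mathrm{V}^\bullet(\psi_1)\cup\mathrm{V}^\bullet(\psi_2)$; $\mathrm{V}^\bullet(\Box\psi)=\mathrm{V}^\bullet(\psi)$. ULIP. $L$ enjoys ULIP if for every $\varphi\in\mathscr{L}_\Box$ and all finite $P^+,P^-\subseteq\mathrm{PropVar}$ there is $\chi\in\mathscr{L}_\Box$ such that: (1) $\mathrm{V}^\bullet(\chi)\subseteq\mathrm{V}^\bullet(\varphi)\setminus P^\bullet$ for each $\bullet\in\{+,-\}$; (2) $L\vdash\varphi\to\chi$; (3) $L\vdash\chi\to\psi$ for every $\psi\in\mathscr{L}_\Box$ such that $L\vdash\varphi\to\psi$ and $\mathrm{V}^\bullet(\psi)\cap P^\bullet=\emptyset$ for each $\bullet\in\{+,-\}$. *)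

theory Defs
  imports Main "HOL-Library.Countable_Set"
begin

datatype 'v fm =
    Var 'v
  | Bot (\<open>\<^bold>\<bottom>\<close>)
  | And "'v fm" "'v fm" (infixr \<open>\<^bold>\<and>\<close> 65)
  | Or "'v fm" "'v fm" (infixr \<open>\<^bold>\<or>\<close> 60)
  | Imp "'v fm" "'v fm" (infixr \<open>\<^bold>\<longrightarrow>\<close> 55)
  | Box "'v fm" (\<open>\<^bold>\<box> _\<close> [70] 70)

abbreviation Neg_fm :: "'v fm \<Rightarrow> 'v fm" (\<open>\<^bold>\<not> _\<close> [70] 70)
  where "\<^bold>\<not> \<phi> \<equiv> \<phi> \<^bold>\<longrightarrow> \<^bold>\<bottom>"

abbreviation Box_iter :: "nat \<Rightarrow> 'v fm \<Rightarrow> 'v fm"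
  where "Box_iter k \<phi> \<equiv> (Box ^^ k) \<phi>"

text \<open>
  Tautologies in the modal language are the substitution instances of classical tautologies,
  i.e. the formulas that are true under every truth assignment treating both the propositional
  variables (assignment \<open>v\<close>) and the boxed formulas (assignment \<open>b\<close>) as atoms.
\<close>

primrec eval :: "('v \<Rightarrow> bool) \<Rightarrow> ('v fm \<Rightarrow> bool) \<Rightarrow> 'v fm \<Rightarrow> bool" where
  "eval v b (Var p) = v p"
| "eval v b \<^bold>\<bottom> = False"
| "eval v b (\<phi> \<^bold>\<and> \<psi>) = (eval v b \<phi> \<and> eval v b \<psi>)"
| "eval v b (\<phi> \<^bold>\<or> \<psi>) = (eval v b \<phi> \<or> eval v b \<psi>)"
| "eval v b (\<phi> \<^bold>\<longrightarrow> \<psi>) = (eval v b \<phi> \<longrightarrow> eval v b \<psi>)"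
| "eval v b (\<^bold>\<box> \<phi>) = b \<phi>"

definition tautology :: "'v fm \<Rightarrow> bool"
  where "tautology \<phi> \<longleftrightarrow> (\<forall>v b. eval v b \<phi>)"

text \<open>
  A logic is identified with its set of theorems. \<open>N_ext A R\<close> is the logic \<open>N\<close> extended by the
  axioms \<open>A\<close> and by the unary rules \<open>R\<close>, where \<open>(\<phi>, \<psi>) \<in> R\<close> means: from the theorem \<open>\<phi>\<close>
  infer \<open>\<psi>\<close>. The logic \<open>N\<close> itself is \<open>N_ext {} {}\<close>.
\<close>

inductive_set N_ext :: "'v fm set \<Rightarrow> ('v fm \<times> 'v fm) set \<Rightarrow> 'v fm set"
  for A :: "'v fm set" and R :: "('v fm \<times> 'v fm) set" where
  Taut: "tautology \<phi> \<Longrightarrow> \<phi> \<in> N_ext A R"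
| MP: "\<phi> \<^bold>\<longrightarrow> \<psi> \<in> N_ext A R \<Longrightarrow> \<phi> \<in> N_ext A R \<Longrightarrow> \<psi> \<in> N_ext A R"
| Nec: "\<phi> \<in> N_ext A R \<Longrightarrow> \<^bold>\<box> \<phi> \<in> N_ext A R"
| Axiom: "\<phi> \<in> A \<Longrightarrow> \<phi> \<in> N_ext A R"
| Rule: "\<phi> \<in> N_ext A R \<Longrightarrow> (\<phi>, \<psi>) \<in> R \<Longrightarrow> \<psi> \<in> N_ext A R"

definition Acc :: "nat \<Rightarrow> nat \<Rightarrow> 'v fm set"
  where "Acc m n = {Box_iter n \<phi> \<^bold>\<longrightarrow> Box_iter m \<phi> | \<phi>. True}"

definition NA :: "nat \<Rightarrow> nat \<Rightarrow> 'v fm set"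
  where "NA m n = N_ext (Acc m n) {}"

definition NplusA :: "nat \<Rightarrow> nat \<Rightarrow> 'v fm set"
  where "NplusA m n = N_ext (Acc m n) {(\<^bold>\<not> \<^bold>\<box> \<phi>, \<^bold>\<not> \<^bold>\<box> \<^bold>\<box> \<phi>) | \<phi>. True}"

definition NRA :: "nat \<Rightarrow> nat \<Rightarrow> 'v fm set"
  where "NRA m n = N_ext (Acc m n) {(\<^bold>\<not> \<phi>, \<^bold>\<not> \<^bold>\<box> \<phi>) | \<phi>. True}"

datatype polarity = Pos | Neg

primrec opposite :: "polarity \<Rightarrow> polarity" where
  "opposite Pos = Neg"
| "opposite Neg = Pos"

primrec vars :: "polarity \<Rightarrow> 'v fm \<Rightarrow> 'v set" where
  "vars s (Var p) = (if s = Pos then {p} else {})"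
| "vars s \<^bold>\<bottom> = {}"
| "vars s (\<phi> \<^bold>\<and> \<psi>) = vars s \<phi> \<union> vars s \<psi>"
| "vars s (\<phi> \<^bold>\<or> \<psi>) = vars s \<phi> \<union> vars s \<psi>"
| "vars s (\<phi> \<^bold>\<longrightarrow> \<psi>) = vars (opposite s) \<phi> \<union> vars s \<psi>"
| "vars s (\<^bold>\<box> \<phi>) = vars s \<phi>"

definition ULIP :: "'v fm set \<Rightarrow> bool" where
  "ULIP L \<longleftrightarrow>
    (\<forall>\<phi> (P :: polarity \<Rightarrow> 'v set). (\<forall>s. finite (P s)) \<longrightarrow>
      (\<exists>\<chi>. (\<forall>s. vars s \<chi> \<subseteq> vars s \<phi> - P s) \<and>
           \<phi> \<^bold>\<longrightarrow> \<chi> \<in> L \<and>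
           (\<forall>\<psi>. \<phi> \<^bold>\<longrightarrow> \<psi> \<in> L \<and> (\<forall>s. vars s \<psi> \<inter> P s = {}) \<longrightarrow> \<chi> \<^bold>\<longrightarrow> \<psi> \<in> L)))"

end

theory Submission
  imports Defs
begin

text \<open>
  A logic closed under classical consequence is determined by the truth assignments (to variables
  and boxed formulas) that verify it. Let \<open>\<chi>\<close> be the disjunction, over all such assignments \<open>M\<^sub>1\<close>
  verifying \<open>\<phi>\<close>, of the conjunction of those signed subformulas of \<open>\<phi>\<close> that are true at \<open>M\<^sub>1\<close> and
  avoid the forbidden variables. If \<open>M\<close> verifies \<open>\<chi>\<close>, pick such an \<open>M\<^sub>1\<close> and amalgamate it with \<open>M\<close>
  into an assignment \<open>M\<^sub>0\<close> of the logic that still verifies \<open>\<phi>\<close>, such that every permitted formula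
  true at \<open>M\<^sub>0\<close> is true at \<open>M\<close>. All axioms and rules only relate formulas that differ in the number of
  leading boxes, and such formulas have the same variables. So \<open>M\<^sub>0\<close> can be defined chain by chain:
  the truth value of a boxed formula is bounded from below and from above by what \<open>M\<^sub>1\<close> and \<open>M\<close>
  force, and between these bounds it copies the value of the formula with its leading boxes removed.
\<close>

section \<open>Models of a logic\<close>

text \<open>Boxed formulas are independent atoms valued by \<open>b\<close>, with no accessibility
  relation: the modal content of \<open>L\<close> enters only through the demand that its theorems
  be true.\<close>

definition model :: "'v fm set \<Rightarrow> ('v \<Rightarrow> bool) \<Rightarrow> ('v fm \<Rightarrow> bool) \<Rightarrow> bool"
  where "model L v b \<longleftrightarrow> (\<forall>\<theta>\<in>L. eval v b \<theta>)"

definition classical_theory :: "'v fm set \<Rightarrow> bool"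
  where "classical_theory L \<longleftrightarrow>
    (\<forall>\<theta>. tautology \<theta> \<longrightarrow> \<theta> \<in> L) \<and> (\<forall>\<alpha> \<beta>. \<alpha> \<^bold>\<longrightarrow> \<beta> \<in> L \<longrightarrow> \<alpha> \<in> L \<longrightarrow> \<beta> \<in> L)"

lemma classical_theory_taut: "classical_theory L \<Longrightarrow> tautology \<theta> \<Longrightarrow> \<theta> \<in> L"
  and classical_theory_mp: "classical_theory L \<Longrightarrow> \<alpha> \<^bold>\<longrightarrow> \<beta> \<in> L \<Longrightarrow> \<alpha> \<in> L \<Longrightarrow> \<beta> \<in> L"
  unfolding classical_theory_def by blast+

lemma classical_theory_N_ext: "classical_theory (N_ext A R)"
  unfolding classical_theory_def by (blast intro: N_ext.Taut N_ext.MP)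

section \<open>Maximal theories and completeness\<close>

text \<open>This set is the closure of \<open>G\<close> with \<alpha> added under classical
  consequence, written so that the deduction theorem holds by definition. It is the competitor in
  the maximality argument.\<close>

lemma classical_theory_relativize:
  assumes "classical_theory G"
  shows "classical_theory {\<beta>. \<alpha> \<^bold>\<longrightarrow> \<beta> \<in> G}"
proof -
  have "\<alpha> \<^bold>\<longrightarrow> \<theta> \<in> G" if "tautology \<theta>" for \<theta>
    using that by (intro classical_theory_taut[OF assms]) (simp add: tautology_def)
  moreover have "\<alpha> \<^bold>\<longrightarrow> \<gamma> \<in> G" if "\<alpha> \<^bold>\<longrightarrow> \<beta> \<^bold>\<longrightarrow> \<gamma> \<in> G" "\<alpha> \<^bold>\<longrightarrow> \<beta> \<in> G" for \<beta> \<gamma>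
  proof -
    have "(\<alpha> \<^bold>\<longrightarrow> \<beta> \<^bold>\<longrightarrow> \<gamma>) \<^bold>\<longrightarrow> (\<alpha> \<^bold>\<longrightarrow> \<beta>) \<^bold>\<longrightarrow> \<alpha> \<^bold>\<longrightarrow> \<gamma> \<in> G"
      by (intro classical_theory_taut[OF assms]) (simp add: tautology_def)
    then show ?thesis
      using that classical_theory_mp[OF assms] by blast
  qed
  ultimately show ?thesis
    by (simp add: classical_theory_def)
qed

text \<open>Zorn's lemma on the classical theories above \<open>L\<close> that omit \<psi>. The last
  property is maximality in usable form: adding a missing \<alpha> must yield \<psi>, so \<psi> can
  play the role of falsum.\<close>

lemma classical_theory_avoiding_maximal:
  assumes "classical_theory L" "\<psi> \<notin> L"
  obtains G where "classical_theory G" "L \<subseteq> G" "\<psi> \<notin> G" "\<And>\<alpha>. \<alpha> \<notin> G \<Longrightarrow> \<alpha> \<^bold>\<longrightarrow> \<psi> \<in> G"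
proof -
  let ?F = "{G. classical_theory G \<and> L \<subseteq> G \<and> \<psi> \<notin> G}"
  have "\<exists>G\<in>?F. \<forall>H\<in>?F. G \<subseteq> H \<longrightarrow> H = G"
  proof (rule subset_Zorn_nonempty)
    show "?F \<noteq> {}" using assms by blast
    fix C assume "C \<noteq> {}" and chain: "subset.chain ?F C"
    then obtain G0 where "G0 \<in> C" by blast
    have F: "classical_theory G" "L \<subseteq> G" "\<psi> \<notin> G" if "G \<in> C" for G
      using chain that by (auto simp: subset_chain_def)
    have "\<beta> \<in> \<Union>C" if mem: "\<alpha> \<^bold>\<longrightarrow> \<beta> \<in> \<Union>C" "\<alpha> \<in> \<Union>C" for \<alpha> \<beta>
    proof -
      obtain G H where GH: "\<alpha> \<^bold>\<longrightarrow> \<beta> \<in> G" "G \<in> C" "\<alpha> \<in> H" "H \<in> C"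
        using mem by blast
      then have "G \<subseteq> H \<or> H \<subseteq> G"
        using chain by (simp add: subset_chain_def)
      then obtain K where "K \<in> C" "\<alpha> \<^bold>\<longrightarrow> \<beta> \<in> K" "\<alpha> \<in> K"
        using GH by blast
      then show ?thesis
        using classical_theory_mp[OF F(1)] by blast
    qed
    moreover have "L \<subseteq> \<Union>C"
      using F(2)[OF \<open>G0 \<in> C\<close>] \<open>G0 \<in> C\<close> by blast
    ultimately have "classical_theory (\<Union>C)"
      unfolding classical_theory_def
      using classical_theory_taut[OF assms(1)] by (auto simp del: Union_iff)
    then show "\<Union>C \<in> ?F"
      using \<open>L \<subseteq> \<Union>C\<close> F(3) by simp
  qed
  then obtain G where G: "classical_theory G" "L \<subseteq> G" "\<psi> \<notin> G"
    and max: "\<And>H. classical_theory H \<Longrightarrow> L \<subseteq> H \<Longrightarrow> \<psi> \<notin> H \<Longrightarrow> G \<subseteq> H \<Longrightarrow> H = G"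
    by auto
  have "\<alpha> \<^bold>\<longrightarrow> \<psi> \<in> G" if "\<alpha> \<notin> G" for \<alpha>
  proof (rule ccontr)
    assume "\<alpha> \<^bold>\<longrightarrow> \<psi> \<notin> G"
    have "\<alpha> \<^bold>\<longrightarrow> \<beta> \<in> G" if "\<beta> \<in> G" for \<beta>
    proof -
      have "\<beta> \<^bold>\<longrightarrow> \<alpha> \<^bold>\<longrightarrow> \<beta> \<in> G"
        by (intro classical_theory_taut[OF G(1)]) (simp add: tautology_def)
      then show ?thesis
        using that classical_theory_mp[OF G(1)] by blast
    qed
    then have "{\<beta>. \<alpha> \<^bold>\<longrightarrow> \<beta> \<in> G} = G"
      using G \<open>\<alpha> \<^bold>\<longrightarrow> \<psi> \<notin> G\<close> by (intro max classical_theory_relativize) auto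
    moreover have "\<alpha> \<^bold>\<longrightarrow> \<alpha> \<in> G"
      by (intro classical_theory_taut[OF G(1)]) (simp add: tautology_def)
    ultimately show False
      using that by blast
  qed
  with G show ?thesis
    by (rule that)
qed

text \<open>Lindenbaum argument: membership in a maximal theory omitting \<psi> commutes with the
  connectives, so it is itself an assignment that verifies \<open>L\<close> and refutes
  \<psi>.\<close>

lemma classical_theory_iff_models:
  assumes L: "classical_theory L"
  shows "\<psi> \<in> L \<longleftrightarrow> (\<forall>v b. model L v b \<longrightarrow> eval v b \<psi>)"
proof
  assume sem: "\<forall>v b. model L v b \<longrightarrow> eval v b \<psi>"
  show "\<psi> \<in> L"
  proof (rule ccontr)
    assume "\<psi> \<notin> L"
    then obtain G where G: "classical_theory G" "L \<subseteq> G" "\<psi> \<notin> G"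
      and max: "\<And>\<alpha>. \<alpha> \<notin> G \<Longrightarrow> \<alpha> \<^bold>\<longrightarrow> \<psi> \<in> G"
      using classical_theory_avoiding_maximal[OF L] by blast
    note mp = classical_theory_mp[OF G(1)]
    have taut: "\<theta> \<in> G" if "\<And>v b. eval v b \<theta>" for \<theta>
      using that by (intro classical_theory_taut[OF G(1)]) (simp add: tautology_def)
    have Bot: "\<^bold>\<bottom> \<notin> G"
      using mp[of "\<^bold>\<bottom>" \<psi>] taut[of "\<^bold>\<bottom> \<^bold>\<longrightarrow> \<psi>"] G(3) by auto
    have Imp: "\<alpha> \<^bold>\<longrightarrow> \<beta> \<in> G \<longleftrightarrow> (\<alpha> \<in> G \<longrightarrow> \<beta> \<in> G)" for \<alpha> \<beta>
    proof (intro iffI impI)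
      assume "\<alpha> \<in> G \<longrightarrow> \<beta> \<in> G"
      show "\<alpha> \<^bold>\<longrightarrow> \<beta> \<in> G"
      proof (cases "\<beta> \<in> G")
        case True
        then show ?thesis
          using mp[of \<beta>] taut[of "\<beta> \<^bold>\<longrightarrow> \<alpha> \<^bold>\<longrightarrow> \<beta>"] by simp
      next
        case False
        then have "\<alpha> \<^bold>\<longrightarrow> \<psi> \<in> G"
          using \<open>\<alpha> \<in> G \<longrightarrow> \<beta> \<in> G\<close> max by blast
        \<comment> \<open>A form of excluded middle: were the implication missing, maximality would
          put both premises of this tautology into \<open>G\<close>, and \<psi> with them.\<close>
        moreover have "((\<alpha> \<^bold>\<longrightarrow> \<beta>) \<^bold>\<longrightarrow> \<psi>) \<^bold>\<longrightarrow> (\<alpha> \<^bold>\<longrightarrow> \<psi>) \<^bold>\<longrightarrow> \<psi> \<in> G"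
          by (rule taut) auto
        ultimately show ?thesis
          using mp max G(3) by blast
      qed
    qed (rule mp)
    have And: "\<alpha> \<^bold>\<and> \<beta> \<in> G \<longleftrightarrow> \<alpha> \<in> G \<and> \<beta> \<in> G" for \<alpha> \<beta>
    proof -
      have "\<alpha> \<^bold>\<and> \<beta> \<^bold>\<longrightarrow> \<alpha> \<in> G" "\<alpha> \<^bold>\<and> \<beta> \<^bold>\<longrightarrow> \<beta> \<in> G" "\<alpha> \<^bold>\<longrightarrow> \<beta> \<^bold>\<longrightarrow> \<alpha> \<^bold>\<and> \<beta> \<in> G"
        by (rule taut, auto)+
      then show ?thesis
        using mp by blast
    qed
    have Or: "\<alpha> \<^bold>\<or> \<beta> \<in> G \<longleftrightarrow> \<alpha> \<in> G \<or> \<beta> \<in> G" for \<alpha> \<beta>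
    proof -
      have "\<alpha> \<^bold>\<longrightarrow> \<alpha> \<^bold>\<or> \<beta> \<in> G" "\<beta> \<^bold>\<longrightarrow> \<alpha> \<^bold>\<or> \<beta> \<in> G"
        "\<alpha> \<^bold>\<or> \<beta> \<^bold>\<longrightarrow> (\<alpha> \<^bold>\<longrightarrow> \<psi>) \<^bold>\<longrightarrow> (\<beta> \<^bold>\<longrightarrow> \<psi>) \<^bold>\<longrightarrow> \<psi> \<in> G"
        by (rule taut, auto)+
      then show ?thesis
        using mp Imp[of "\<alpha> \<^bold>\<or> \<beta>"] Imp[of "\<alpha> \<^bold>\<longrightarrow> \<psi>"] Imp[of "\<beta> \<^bold>\<longrightarrow> \<psi>"] max[of \<alpha>] max[of \<beta>] G(3)
        by blast
    qed
    have truth: "eval (\<lambda>p. Var p \<in> G) (\<lambda>\<theta>. \<^bold>\<box> \<theta> \<in> G) \<theta> \<longleftrightarrow> \<theta> \<in> G" for \<theta>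
      by (induction \<theta>) (simp_all add: Bot Imp And Or)
    have "model L (\<lambda>p. Var p \<in> G) (\<lambda>\<theta>. \<^bold>\<box> \<theta> \<in> G) \<longrightarrow> \<psi> \<in> G"
      using sem truth[of \<psi>] by metis
    then show False
      using truth G unfolding model_def by auto
  qed
qed (simp add: model_def)

lemmas N_ext_iff_models = classical_theory_iff_models[OF classical_theory_N_ext]

section \<open>Chains of boxes and signed subformulas\<close>

text \<open>Equality of \<open>core\<close> means differing only in the number of leading boxes; its
  classes are the chains.\<close>

fun core :: "'v fm \<Rightarrow> 'v fm" where
  "core (\<^bold>\<box> \<theta>) = core \<theta>"
| "core \<theta> = \<theta>"

lemma core_core [simp]: "core (core \<theta>) = core \<theta>"
  by (induction \<theta> rule: core.induct) simp_all

lemma core_Box_iter [simp]: "core (Box_iter k \<theta>) = core \<theta>"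
  by (induction k) simp_all

lemma vars_core [simp]: "vars s (core \<theta>) = vars s \<theta>"
  by (induction \<theta> rule: core.induct) simp_all

lemma size_core: "size (core \<theta>) \<le> size \<theta>"
  by (induction \<theta> rule: core.induct) simp_all

lemma core_eq_self: "(\<And>\<eta>. \<theta> \<noteq> \<^bold>\<box> \<eta>) \<Longrightarrow> core \<theta> = \<theta>"
  by (cases \<theta>) auto

lemma opposite_opposite [simp]: "opposite (opposite s) = s"
  by (cases s) simp_all

section \<open>Signed subformulas and their variables\<close>

text \<open>Negating a subformula in negative position lets one statement about truth cover both
  polarities, and gives its variables the polarities they have in the whole formula.\<close>

primrec signed :: "polarity \<Rightarrow> 'v fm \<Rightarrow> 'v fm" where
  "signed Pos \<theta> = \<theta>"
| "signed Neg \<theta> = \<^bold>\<not> \<theta>"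

primrec subformulas :: "polarity \<Rightarrow> 'v fm \<Rightarrow> (polarity \<times> 'v fm) set" where
  "subformulas s (Var p) = {(s, Var p)}"
| "subformulas s \<^bold>\<bottom> = {(s, \<^bold>\<bottom>)}"
| "subformulas s (\<alpha> \<^bold>\<and> \<beta>) = insert (s, \<alpha> \<^bold>\<and> \<beta>) (subformulas s \<alpha> \<union> subformulas s \<beta>)"
| "subformulas s (\<alpha> \<^bold>\<or> \<beta>) = insert (s, \<alpha> \<^bold>\<or> \<beta>) (subformulas s \<alpha> \<union> subformulas s \<beta>)"
| "subformulas s (\<alpha> \<^bold>\<longrightarrow> \<beta>) =
    insert (s, \<alpha> \<^bold>\<longrightarrow> \<beta>) (subformulas (opposite s) \<alpha> \<union> subformulas s \<beta>)"
| "subformulas s (\<^bold>\<box> \<alpha>) = insert (s, \<^bold>\<box> \<alpha>) (subformulas s \<alpha>)"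

lemma finite_subformulas: "finite (subformulas s \<phi>)"
  by (induction \<phi> arbitrary: s) simp_all

lemma subformulas_self: "(s, \<phi>) \<in> subformulas s \<phi>"
  by (cases \<phi>) simp_all

lemma vars_signed_And [simp]:
    "vars r (signed s (\<alpha> \<^bold>\<and> \<beta>)) = vars r (signed s \<alpha>) \<union> vars r (signed s \<beta>)"
  and vars_signed_Or [simp]:
    "vars r (signed s (\<alpha> \<^bold>\<or> \<beta>)) = vars r (signed s \<alpha>) \<union> vars r (signed s \<beta>)"
  and vars_signed_Imp [simp]:
    "vars r (signed s (\<alpha> \<^bold>\<longrightarrow> \<beta>)) = vars r (signed (opposite s) \<alpha>) \<union> vars r (signed s \<beta>)"
  and vars_signed_Box [simp]: "vars r (signed s (\<^bold>\<box> \<alpha>)) = vars r (signed s \<alpha>)"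
  by (cases s; simp)+

lemma vars_subformulas:
  "(t, \<theta>) \<in> subformulas s \<phi> \<Longrightarrow> vars r (signed t \<theta>) \<subseteq> vars r (signed s \<phi>)"
proof (induction \<phi> arbitrary: s)
  case (And \<alpha> \<beta>)
  then consider "(t, \<theta>) = (s, \<alpha> \<^bold>\<and> \<beta>)" | "(t, \<theta>) \<in> subformulas s \<alpha>" | "(t, \<theta>) \<in> subformulas s \<beta>"
    by auto
  then show ?case using And.IH by cases (simp_all add: le_supI1 le_supI2)
next
  case (Or \<alpha> \<beta>)
  then consider "(t, \<theta>) = (s, \<alpha> \<^bold>\<or> \<beta>)" | "(t, \<theta>) \<in> subformulas s \<alpha>" | "(t, \<theta>) \<in> subformulas s \<beta>"
    by auto
  then show ?case using Or.IH by cases (simp_all add: le_supI1 le_supI2)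
next
  case (Imp \<alpha> \<beta>)
  then consider "(t, \<theta>) = (s, \<alpha> \<^bold>\<longrightarrow> \<beta>)" | "(t, \<theta>) \<in> subformulas (opposite s) \<alpha>"
    | "(t, \<theta>) \<in> subformulas s \<beta>"
    by auto
  then show ?case using Imp.IH by cases (simp_all add: le_supI1 le_supI2)
next
  case (Box \<alpha>)
  then consider "(t, \<theta>) = (s, \<^bold>\<box> \<alpha>)" | "(t, \<theta>) \<in> subformulas s \<alpha>"
    by auto
  then show ?case using Box.IH by cases simp_all
qed simp_all

lemma subformulas_And:
  "(t, \<alpha> \<^bold>\<and> \<beta>) \<in> subformulas s \<phi> \<Longrightarrow> (t, \<alpha>) \<in> subformulas s \<phi> \<and> (t, \<beta>) \<in> subformulas s \<phi>"
  by (induction \<phi> arbitrary: s) (auto simp: subformulas_self)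

lemma subformulas_Or:
  "(t, \<alpha> \<^bold>\<or> \<beta>) \<in> subformulas s \<phi> \<Longrightarrow> (t, \<alpha>) \<in> subformulas s \<phi> \<and> (t, \<beta>) \<in> subformulas s \<phi>"
  by (induction \<phi> arbitrary: s) (auto simp: subformulas_self)

lemma subformulas_Imp:
  "(t, \<alpha> \<^bold>\<longrightarrow> \<beta>) \<in> subformulas s \<phi> \<Longrightarrow>
    (opposite t, \<alpha>) \<in> subformulas s \<phi> \<and> (t, \<beta>) \<in> subformulas s \<phi>"
  by (induction \<phi> arbitrary: s) (auto simp: subformulas_self)

lemma subformulas_Box:
  "(t, \<^bold>\<box> \<alpha>) \<in> subformulas s \<phi> \<Longrightarrow> (t, \<alpha>) \<in> subformulas s \<phi>"
  by (induction \<phi> arbitrary: s) (auto simp: subformulas_self)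

lemma subformulas_core:
  "(t, \<theta>) \<in> subformulas s \<phi> \<Longrightarrow> (t, core \<theta>) \<in> subformulas s \<phi>"
  by (induction \<theta> rule: core.induct) (auto dest: subformulas_Box)

section \<open>Amalgamation of models\<close>

text \<open>These signed formulas are the permitted ones: the interpolant is assembled from them,
  and their truth has to pass from the amalgam to \<open>(v, b)\<close>.\<close>

definition avoids :: "(polarity \<Rightarrow> 'v set) \<Rightarrow> polarity \<Rightarrow> 'v fm \<Rightarrow> bool"
  where "avoids P s \<theta> \<longleftrightarrow> (\<forall>t. vars t (signed s \<theta>) \<inter> P t = {})"

lemma avoids_And [simp]: "avoids P s (\<alpha> \<^bold>\<and> \<beta>) \<longleftrightarrow> avoids P s \<alpha> \<and> avoids P s \<beta>"
  and avoids_Or [simp]: "avoids P s (\<alpha> \<^bold>\<or> \<beta>) \<longleftrightarrow> avoids P s \<alpha> \<and> avoids P s \<beta>"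
  and avoids_Imp [simp]: "avoids P s (\<alpha> \<^bold>\<longrightarrow> \<beta>) \<longleftrightarrow> avoids P (opposite s) \<alpha> \<and> avoids P s \<beta>"
  and avoids_Box [simp]: "avoids P s (\<^bold>\<box> \<alpha>) \<longleftrightarrow> avoids P s \<alpha>"
  by (auto simp: avoids_def)

lemma avoids_cong_core: "core \<theta> = core \<eta> \<Longrightarrow> avoids P s \<theta> \<longleftrightarrow> avoids P s \<eta>"
proof -
  assume "core \<theta> = core \<eta>"
  then have "vars t \<theta> = vars t \<eta>" for t
    using vars_core by metis
  then show ?thesis
    by (cases s) (simp_all add: avoids_def)
qed

text \<open>
  \<open>\<phi>\<close> is true at \<open>(v1, b1)\<close>, and \<open>(v, b)\<close> is the assignment at which the disjunct of the
  interpolant given by \<open>(v1, b1)\<close> is true.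
\<close>

locale amalgamation =
  fixes A :: "'v fm set" and R :: "('v fm \<times> 'v fm) set"
    and \<phi> :: "'v fm" and P :: "polarity \<Rightarrow> 'v set"
    and v1 v :: "'v \<Rightarrow> bool" and b1 b :: "'v fm \<Rightarrow> bool"
  assumes model1: "model (N_ext A R) v1 b1" and model: "model (N_ext A R) v b"
    and transfer: "\<And>s \<theta>. (s, \<theta>) \<in> subformulas Pos \<phi> \<Longrightarrow> avoids P s \<theta> \<Longrightarrow>
      eval v1 b1 (signed s \<theta>) \<Longrightarrow> eval v b (signed s \<theta>)"
begin

section \<open>Bounds on truth values and the amalgamated assignment\<close>

abbreviation "L \<equiv> N_ext A R"
abbreviation "S \<equiv> subformulas Pos \<phi>"

text \<open>Reasons that force \<theta> to be true at the amalgam: a true positive subformula of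
  \<phi> provably implies it, or it holds at \<open>(v, b)\<close> and its negation is permitted, so
  that falsity would have to pass to \<open>(v, b)\<close>. Keeping \<alpha> in the chain of
  \<theta> makes both use the same variables.\<close>

definition lower :: "'v fm \<Rightarrow> bool"
  where "lower \<theta> \<longleftrightarrow>
    (\<exists>\<alpha>. (Pos, \<alpha>) \<in> S \<and> eval v1 b1 \<alpha> \<and> core \<alpha> = core \<theta> \<and> \<alpha> \<^bold>\<longrightarrow> \<theta> \<in> L) \<or>
    eval v b \<theta> \<and> avoids P Neg \<theta>"

text \<open>Dual to \<open>lower\<close>: it fails exactly when there is a reason that forces
  \<theta> to be false.\<close>

definition upper :: "'v fm \<Rightarrow> bool"
  where "upper \<theta> \<longleftrightarrow>
    \<not> (\<exists>\<alpha>. (Neg, \<alpha>) \<in> S \<and> \<not> eval v1 b1 \<alpha> \<and> core \<alpha> = core \<theta> \<and> \<theta> \<^bold>\<longrightarrow> \<alpha> \<in> L) \<and>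
    \<not> (\<not> eval v b \<theta> \<and> avoids P Pos \<theta>)"

text \<open>A boxed formula gets the value of its core, clamped between the two bounds. Recursion to
  \<open>core \<theta>\<close> instead of \<theta> gives all boxed members of a chain the same
  reference value. Variables take the least value that the bounds allow.\<close>

function val :: "'v fm \<Rightarrow> bool" where
  "val (Var p) = lower (Var p)"
| "val \<^bold>\<bottom> = False"
| "val (\<alpha> \<^bold>\<and> \<beta>) = (val \<alpha> \<and> val \<beta>)"
| "val (\<alpha> \<^bold>\<or> \<beta>) = (val \<alpha> \<or> val \<beta>)"
| "val (\<alpha> \<^bold>\<longrightarrow> \<beta>) = (val \<alpha> \<longrightarrow> val \<beta>)"
| "val (\<^bold>\<box> \<theta>) = (lower (\<^bold>\<box> \<theta>) \<or> upper (\<^bold>\<box> \<theta>) \<and> val (core \<theta>))"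
  by pat_completeness auto
termination
  by (relation "measure size") (auto simp: less_Suc_eq_le size_core)

lemma eval_val: "eval (\<lambda>p. val (Var p)) (\<lambda>\<theta>. val (\<^bold>\<box> \<theta>)) \<theta> = val \<theta>"
  by (induction \<theta>) simp_all

lemma sound1: "\<theta> \<in> L \<Longrightarrow> eval v1 b1 \<theta>"
  and sound: "\<theta> \<in> L \<Longrightarrow> eval v b \<theta>"
  using model1 model unfolding model_def by blast+

lemma sound1_Imp: "\<alpha> \<^bold>\<longrightarrow> \<beta> \<in> L \<Longrightarrow> eval v1 b1 \<alpha> \<Longrightarrow> eval v1 b1 \<beta>"
  and sound_Imp: "\<alpha> \<^bold>\<longrightarrow> \<beta> \<in> L \<Longrightarrow> eval v b \<alpha> \<Longrightarrow> eval v b \<beta>"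
  using sound1[of "\<alpha> \<^bold>\<longrightarrow> \<beta>"] sound[of "\<alpha> \<^bold>\<longrightarrow> \<beta>"] by simp_all

lemma sound1_Neg: "\<^bold>\<not> \<alpha> \<in> L \<Longrightarrow> \<not> eval v1 b1 \<alpha>"
  and sound_Neg: "\<^bold>\<not> \<alpha> \<in> L \<Longrightarrow> \<not> eval v b \<alpha>"
  using sound1[of "\<^bold>\<not> \<alpha>"] sound[of "\<^bold>\<not> \<alpha>"] by simp_all

lemma transfer_Pos: "(Pos, \<theta>) \<in> S \<Longrightarrow> avoids P Pos \<theta> \<Longrightarrow> eval v1 b1 \<theta> \<Longrightarrow> eval v b \<theta>"
  and transfer_Neg: "(Neg, \<theta>) \<in> S \<Longrightarrow> avoids P Neg \<theta> \<Longrightarrow> eval v b \<theta> \<Longrightarrow> eval v1 b1 \<theta>"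
  using transfer[of Pos \<theta>] transfer[of Neg \<theta>] by auto

lemma Imp_refl: "\<alpha> \<^bold>\<longrightarrow> \<alpha> \<in> L"
  by (simp add: N_ext_iff_models)

lemma Imp_trans: "\<alpha> \<^bold>\<longrightarrow> \<beta> \<in> L \<Longrightarrow> \<beta> \<^bold>\<longrightarrow> \<gamma> \<in> L \<Longrightarrow> \<alpha> \<^bold>\<longrightarrow> \<gamma> \<in> L"
  by (simp add: N_ext_iff_models)

lemma theorem_Imp: "\<beta> \<in> L \<Longrightarrow> \<alpha> \<^bold>\<longrightarrow> \<beta> \<in> L"
  by (simp add: N_ext_iff_models)

lemma refuted_Imp: "\<^bold>\<not> \<alpha> \<in> L \<Longrightarrow> \<alpha> \<^bold>\<longrightarrow> \<beta> \<in> L"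
  by (simp add: N_ext_iff_models)

text \<open>A witness composes with the given implication, the other reason survives because
  \<open>(v, b)\<close> verifies \<open>L\<close>, and permission is constant on a chain.\<close>

lemma lower_mono:
  assumes "core \<theta> = core \<eta>" "\<theta> \<^bold>\<longrightarrow> \<eta> \<in> L" "lower \<theta>"
  shows "lower \<eta>"
  using assms(3) unfolding lower_def assms(1) avoids_cong_core[OF assms(1)]
  by (blast intro: Imp_trans[OF _ assms(2)] sound_Imp[OF assms(2)])

lemma upper_mono:
  assumes "core \<theta> = core \<eta>" "\<theta> \<^bold>\<longrightarrow> \<eta> \<in> L" "upper \<theta>"
  shows "upper \<eta>"
  using assms(3) unfolding upper_def assms(1) avoids_cong_core[OF assms(1)]
  by (blast intro: Imp_trans[OF assms(2)] sound_Imp[OF assms(2)])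

lemma upper_theorem: "\<theta> \<in> L \<Longrightarrow> upper \<theta>"
  unfolding upper_def using sound sound1 sound1_Imp by blast

lemma not_lower_refuted: "\<^bold>\<not> \<theta> \<in> L \<Longrightarrow> \<not> lower \<theta>"
  unfolding lower_def using sound_Neg sound1_Neg sound1_Imp by blast

text \<open>A forcing subformula lies in the chain of \<theta> and so is permitted too; it transfers
  to \<open>(v, b)\<close>, and the provable implication carries truth on to \<theta>.\<close>

lemma lower_avoids_Pos: "lower \<theta> \<Longrightarrow> avoids P Pos \<theta> \<Longrightarrow> eval v b \<theta>"
  unfolding lower_def using transfer_Pos sound_Imp avoids_cong_core by blast

lemma lower_subformula: "(Pos, \<theta>) \<in> S \<Longrightarrow> eval v1 b1 \<theta> \<Longrightarrow> lower \<theta>"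
  unfolding lower_def using Imp_refl by blast

text \<open>The bounds do not conflict here: a forcing implication would make \<theta> true at
  \<open>(v1, b1)\<close>, and so would the contrapositive of the transfer in the other
  case.\<close>

lemma not_lower_subformula: "(Neg, \<theta>) \<in> S \<Longrightarrow> \<not> eval v1 b1 \<theta> \<Longrightarrow> \<not> lower \<theta>"
  unfolding lower_def using transfer_Neg sound1_Imp by blast

lemma not_upper_subformula: "(Neg, \<theta>) \<in> S \<Longrightarrow> \<not> eval v1 b1 \<theta> \<Longrightarrow> \<not> upper \<theta>"
  unfolding upper_def using Imp_refl by blast

lemma lower_avoids_Neg: "avoids P Neg \<theta> \<Longrightarrow> eval v b \<theta> \<Longrightarrow> lower \<theta>"
  and upper_avoids_Pos: "avoids P Pos \<theta> \<Longrightarrow> upper \<theta> \<Longrightarrow> eval v b \<theta>"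
  unfolding lower_def upper_def by blast+

section \<open>Agreement of the amalgam with the two given assignments\<close>

text \<open>Both polarities share one induction because implication swaps them. The box case uses no
  induction hypothesis: the bounds alone settle the value of a permitted boxed formula.\<close>

lemma val_avoids:
  "(avoids P Pos \<theta> \<longrightarrow> val \<theta> \<longrightarrow> eval v b \<theta>) \<and> (avoids P Neg \<theta> \<longrightarrow> eval v b \<theta> \<longrightarrow> val \<theta>)"
proof (induction \<theta>)
  case (Var p)
  show ?case
    using lower_avoids_Pos[of "Var p"] lower_avoids_Neg[of "Var p"] by simp
next
  case (Box \<theta>)
  show ?case
    using lower_avoids_Pos[of "\<^bold>\<box> \<theta>"] lower_avoids_Neg[of "\<^bold>\<box> \<theta>"] upper_avoids_Pos[of "\<^bold>\<box> \<theta>"]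
    by auto
qed auto

lemma val_subformula:
  "((Pos, \<theta>) \<in> S \<longrightarrow> eval v1 b1 \<theta> \<longrightarrow> val \<theta>) \<and> ((Neg, \<theta>) \<in> S \<longrightarrow> val \<theta> \<longrightarrow> eval v1 b1 \<theta>)"
proof (induction \<theta>)
  case (Var p)
  show ?case
    using lower_subformula[of "Var p"] not_lower_subformula[of "Var p"] by auto
next
  case (Box \<theta>)
  show ?case
    using lower_subformula[of "\<^bold>\<box> \<theta>"] not_lower_subformula[of "\<^bold>\<box> \<theta>"]
      not_upper_subformula[of "\<^bold>\<box> \<theta>"] by auto
next
  case (And \<alpha> \<beta>)
  then show ?case using subformulas_And[of _ \<alpha> \<beta> Pos \<phi>] by fastforce
next
  case (Or \<alpha> \<beta>)
  then show ?case using subformulas_Or[of _ \<alpha> \<beta> Pos \<phi>] by fastforce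
next
  case (Imp \<alpha> \<beta>)
  then show ?case using subformulas_Imp[of _ \<alpha> \<beta> Pos \<phi>] by fastforce
qed auto

lemma val_phi: "eval v1 b1 \<phi> \<Longrightarrow> val \<phi>"
  using val_subformula subformulas_self by blast

section \<open>Truth of the axioms and rules at the amalgam\<close>

text \<open>A compound core is evaluated by its connectives, not by the bounds. The reason behind
  \<open>lower \<theta>\<close> still applies to it, since signed subformulas are closed under
  \<open>core\<close> and the implication is sound; agreement with the given assignments then yields
  its truth.\<close>

lemma lower_imp_val_core:
  assumes "lower \<theta>" "\<theta> \<^bold>\<longrightarrow> core \<theta> \<in> L"
  shows "val (core \<theta>)"
  using assms(1) unfolding lower_def
proof (elim disjE exE conjE)
  fix \<alpha> assume \<alpha>: "(Pos, \<alpha>) \<in> S" "eval v1 b1 \<alpha>" "core \<alpha> = core \<theta>" "\<alpha> \<^bold>\<longrightarrow> \<theta> \<in> L"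
  then have "(Pos, core \<theta>) \<in> S"
    using subformulas_core by metis
  moreover have "eval v1 b1 (core \<theta>)"
    using \<alpha> sound1[of "\<alpha> \<^bold>\<longrightarrow> \<theta>"] sound1[OF assms(2)] by simp
  ultimately show ?thesis
    using val_subformula by blast
next
  assume "eval v b \<theta>" "avoids P Neg \<theta>"
  then show ?thesis
    using val_avoids[of "core \<theta>"] sound[OF assms(2)] avoids_cong_core[OF core_core[of \<theta>], of P] by auto
qed

lemma val_core_imp_upper:
  assumes "val (core \<theta>)" "core \<theta> \<^bold>\<longrightarrow> \<theta> \<in> L"
  shows "upper \<theta>"
  unfolding upper_def
proof (intro conjI notI; elim exE conjE)
  fix \<alpha> assume \<alpha>: "(Neg, \<alpha>) \<in> S" "\<not> eval v1 b1 \<alpha>" "core \<alpha> = core \<theta>" "\<theta> \<^bold>\<longrightarrow> \<alpha> \<in> L"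
  then have "(Neg, core \<theta>) \<in> S"
    using subformulas_core by metis
  moreover have "\<not> eval v1 b1 (core \<theta>)"
    using \<alpha> sound1[of "\<theta> \<^bold>\<longrightarrow> \<alpha>"] sound1[OF assms(2)] by auto
  ultimately show False
    using val_subformula assms(1) by blast
next
  assume "\<not> eval v b \<theta>" "avoids P Pos \<theta>"
  then show False
    using val_avoids[of "core \<theta>"] sound[OF assms(2)] avoids_cong_core[OF core_core[of \<theta>], of P] assms(1)
    by auto
qed

text \<open>Two boxed formulas share the value of their core, so monotone bounds suffice. A side
  without leading box, as can occur in an axiom with exponent 0, is the core itself and is compared
  with the bounds of the other side.\<close>

lemma val_chain_mono:
  assumes "core \<theta> = core \<eta>" "\<theta> \<^bold>\<longrightarrow> \<eta> \<in> L" "val \<theta>"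
  shows "val \<eta>"
proof (cases "\<exists>\<theta>'. \<theta> = \<^bold>\<box> \<theta>'")
  case True
  then obtain \<theta>' where \<theta>: "\<theta> = \<^bold>\<box> \<theta>'" by blast
  show ?thesis
  proof (cases "\<exists>\<eta>'. \<eta> = \<^bold>\<box> \<eta>'")
    case True
    then show ?thesis
      using assms \<theta> lower_mono[OF assms(1,2)] upper_mono[OF assms(1,2)] by auto
  next
    case False
    then have "core \<theta> = \<eta>"
      using assms(1) core_eq_self by metis
    then show ?thesis
      using assms \<theta> lower_imp_val_core[of \<theta>] by auto
  qed
next
  case False
  then have \<theta>: "core \<eta> = \<theta>"
    using assms(1) core_eq_self by metis
  show ?thesis
  proof (cases "\<exists>\<eta>'. \<eta> = \<^bold>\<box> \<eta>'")
    case True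
    then show ?thesis
      using assms \<theta> val_core_imp_upper[of \<eta>] by auto
  next
    case False
    then have "core \<eta> = \<eta>"
      using core_eq_self by blast
    then show ?thesis
      using \<theta> assms by simp
  qed
qed

lemma val_Box_theorem:
  assumes "\<theta> \<in> L" "val \<theta>"
  shows "val (\<^bold>\<box> \<theta>)"
proof -
  have Box: "\<^bold>\<box> \<theta> \<in> L"
    using assms(1) by (rule N_ext.Nec)
  \<comment> \<open>A boxed \<theta> may be true by its lower bound alone while its core is false;
    that bound then passes to the next box. Otherwise the true core is copied, as the upper bound of
    a theorem holds.\<close>
  have "val (core \<theta>) \<or> lower \<theta>"
    using assms(2) core_eq_self[of \<theta>] by (cases \<theta>) auto
  moreover have "lower \<theta> \<Longrightarrow> lower (\<^bold>\<box> \<theta>)"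
    using lower_mono[of \<theta> "\<^bold>\<box> \<theta>"] theorem_Imp[OF Box] by simp
  ultimately show ?thesis
    using upper_theorem[OF Box] by auto
qed

text \<open>Dual of necessitation, phrased to cover both refutation rules. A refuted box has a false
  lower bound, so its truth would need a true core and a true upper bound; the latter passes to
  \<theta>, as a refuted formula implies everything, and \<theta> would be true.\<close>

lemma not_val_Box_refuted:
  assumes "\<^bold>\<not> \<^bold>\<box> \<eta> \<in> L" "core \<theta> = core \<eta>" "\<not> val \<theta>"
  shows "\<not> val (\<^bold>\<box> \<eta>)"
proof -
  have "\<not> val (core \<theta>) \<or> \<not> upper \<theta>"
    using assms(3) by (cases \<theta>) auto
  moreover have "upper (\<^bold>\<box> \<eta>) \<Longrightarrow> upper \<theta>"
    using upper_mono[of "\<^bold>\<box> \<eta>" \<theta>] refuted_Imp[OF assms(1)] assms(2) by simp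
  ultimately show ?thesis
    using not_lower_refuted[OF assms(1)] assms(2) by auto
qed

text \<open>The cases of necessitation and of the rules use derivability as well as truth at the
  amalgam, hence the induction over derivations.\<close>

lemma model_val:
  assumes A: "\<And>\<alpha>. \<alpha> \<in> A \<Longrightarrow> \<exists>\<theta> \<eta>. \<alpha> = \<theta> \<^bold>\<longrightarrow> \<eta> \<and> core \<theta> = core \<eta>"
    and R: "\<And>\<alpha> \<beta>. (\<alpha>, \<beta>) \<in> R \<Longrightarrow> \<exists>\<theta> \<eta>. \<alpha> = \<^bold>\<not> \<theta> \<and> \<beta> = \<^bold>\<not> \<^bold>\<box> \<eta> \<and> core \<theta> = core \<eta>"
  shows "\<theta> \<in> L \<Longrightarrow> val \<theta>"
proof (induction rule: N_ext.induct)
  case (Taut \<theta>)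
  then show ?case
    using eval_val unfolding tautology_def by blast
next
  case (MP \<theta> \<eta>)
  then show ?case by simp
next
  case (Nec \<theta>)
  then show ?case by (rule val_Box_theorem)
next
  case (Axiom \<alpha>)
  then show ?case
    using A[of \<alpha>] N_ext.Axiom[of \<alpha> A R] val_chain_mono by auto
next
  case (Rule \<alpha> \<beta>)
  then show ?case
    using R[of \<alpha> \<beta>] N_ext.Rule[of \<alpha> A R \<beta>] not_val_Box_refuted by fastforce
qed

end

section \<open>Uniform Lyndon interpolation\<close>

lemma finite_conjunction:
  assumes "finite T"
  shows "\<exists>\<gamma>. (\<forall>v b. eval v b \<gamma> \<longleftrightarrow> (\<forall>\<theta>\<in>T. eval v b \<theta>)) \<and> (\<forall>s. vars s \<gamma> \<subseteq> (\<Union>\<theta>\<in>T. vars s \<theta>))"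
  using assms
proof (induction T rule: finite_induct)
  case empty
  show ?case by (rule exI[of _ "\<^bold>\<not> \<^bold>\<bottom>"]) simp
next
  case (insert \<theta> T)
  then obtain \<gamma> where "\<forall>v b. eval v b \<gamma> \<longleftrightarrow> (\<forall>\<theta>\<in>T. eval v b \<theta>)"
    "\<forall>s. vars s \<gamma> \<subseteq> (\<Union>\<theta>\<in>T. vars s \<theta>)"
    by blast
  then show ?case by (intro exI[of _ "\<theta> \<^bold>\<and> \<gamma>"]) auto
qed

lemma finite_disjunction:
  assumes "finite T"
  shows "\<exists>\<gamma>. (\<forall>v b. eval v b \<gamma> \<longleftrightarrow> (\<exists>\<theta>\<in>T. eval v b \<theta>)) \<and> (\<forall>s. vars s \<gamma> \<subseteq> (\<Union>\<theta>\<in>T. vars s \<theta>))"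
  using assms
proof (induction T rule: finite_induct)
  case empty
  show ?case by (rule exI[of _ "\<^bold>\<bottom>"]) simp
next
  case (insert \<theta> T)
  then obtain \<gamma> where "\<forall>v b. eval v b \<gamma> \<longleftrightarrow> (\<exists>\<theta>\<in>T. eval v b \<theta>)"
    "\<forall>s. vars s \<gamma> \<subseteq> (\<Union>\<theta>\<in>T. vars s \<theta>)"
    by blast
  then show ?case by (intro exI[of _ "\<theta> \<^bold>\<or> \<gamma>"]) auto
qed

lemma finite_disjunctive_normal_form:
  assumes "finite T"
  obtains \<chi> where "\<And>s. vars s \<chi> \<subseteq> (\<Union>\<theta>\<in>T. vars s \<theta>)"
    "\<And>v b. eval v b \<chi> \<longleftrightarrow> (\<exists>v1 b1. M v1 b1 \<and> (\<forall>\<theta>\<in>T. eval v1 b1 \<theta> \<longrightarrow> eval v b \<theta>))"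
proof -
  \<comment> \<open>A disjunct depends only on which members of \<open>T\<close> are true at an
    assignment, so all assignments satisfying \<open>M\<close> leave only finitely many
    disjuncts.\<close>
  define D where "D = (\<lambda>(v1, b1). {\<theta>\<in>T. eval v1 b1 \<theta>}) ` {(v1, b1). M v1 b1}"
  have D: "D \<subseteq> Pow T"
    unfolding D_def by blast
  then have "\<forall>X\<in>D. \<exists>\<gamma>. (\<forall>v b. eval v b \<gamma> \<longleftrightarrow> (\<forall>\<theta>\<in>X. eval v b \<theta>)) \<and>
      (\<forall>s. vars s \<gamma> \<subseteq> (\<Union>\<theta>\<in>X. vars s \<theta>))"
    using assms by (blast intro: finite_conjunction finite_subset)
  then obtain conj where conj: "\<And>X v b. X \<in> D \<Longrightarrow> eval v b (conj X) \<longleftrightarrow> (\<forall>\<theta>\<in>X. eval v b \<theta>)"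
    "\<And>X s. X \<in> D \<Longrightarrow> vars s (conj X) \<subseteq> (\<Union>\<theta>\<in>X. vars s \<theta>)"
    by metis
  have "finite (conj ` D)"
    using D assms by (simp add: finite_subset)
  then obtain \<chi> where \<chi>: "\<And>v b. eval v b \<chi> \<longleftrightarrow> (\<exists>\<gamma>\<in>conj ` D. eval v b \<gamma>)"
    "\<And>s. vars s \<chi> \<subseteq> (\<Union>\<gamma>\<in>conj ` D. vars s \<gamma>)"
    using finite_disjunction by meson
  show ?thesis
  proof
    show "vars s \<chi> \<subseteq> (\<Union>\<theta>\<in>T. vars s \<theta>)" for s
      using \<chi>(2) conj(2) D by fastforce
    have "eval v b \<chi> \<longleftrightarrow> (\<exists>X\<in>D. \<forall>\<theta>\<in>X. eval v b \<theta>)" for v b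
      using \<chi>(1) conj(1) by auto
    then show "eval v b \<chi> \<longleftrightarrow> (\<exists>v1 b1. M v1 b1 \<and> (\<forall>\<theta>\<in>T. eval v1 b1 \<theta> \<longrightarrow> eval v b \<theta>))" for v b
      unfolding D_def by (simp add: Ball_def imp_conjL)
  qed
qed

section \<open>Construction of the interpolant\<close>

text \<open>The hypotheses confine each axiom and rule to a single chain, which is what the
  chainwise definition of the amalgam relies on.\<close>

theorem ULIP_N_ext:
  fixes A :: "'v fm set" and R :: "('v fm \<times> 'v fm) set"
  assumes A: "\<And>\<alpha>. \<alpha> \<in> A \<Longrightarrow> \<exists>\<theta> \<eta>. \<alpha> = \<theta> \<^bold>\<longrightarrow> \<eta> \<and> core \<theta> = core \<eta>"
    and R: "\<And>\<alpha> \<beta>. (\<alpha>, \<beta>) \<in> R \<Longrightarrow> \<exists>\<theta> \<eta>. \<alpha> = \<^bold>\<not> \<theta> \<and> \<beta> = \<^bold>\<not> \<^bold>\<box> \<eta> \<and> core \<theta> = core \<eta>"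
  shows "ULIP (N_ext A R)"
  unfolding ULIP_def
proof (intro allI impI)
  fix \<phi> :: "'v fm" and P :: "polarity \<Rightarrow> 'v set"
  let ?L = "N_ext A R"
  define T where
    "T = (\<lambda>(s, \<theta>). signed s \<theta>) ` {(s, \<theta>) \<in> subformulas Pos \<phi>. avoids P s \<theta>}"
  have "finite T"
    unfolding T_def
    by (intro finite_imageI finite_subset[OF _ finite_subformulas[of Pos \<phi>]]) auto
  then obtain \<chi> where vars_\<chi>: "\<And>s. vars s \<chi> \<subseteq> (\<Union>\<theta>\<in>T. vars s \<theta>)"
    and eval_\<chi>: "\<And>v b. eval v b \<chi> \<longleftrightarrow>
      (\<exists>v1 b1. (model ?L v1 b1 \<and> eval v1 b1 \<phi>) \<and> (\<forall>\<theta>\<in>T. eval v1 b1 \<theta> \<longrightarrow> eval v b \<theta>))"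
    by (rule finite_disjunctive_normal_form[where M = "\<lambda>v1 b1. model ?L v1 b1 \<and> eval v1 b1 \<phi>"])
      (rule that)
  have "vars s \<theta> \<subseteq> vars s \<phi> - P s" if "\<theta> \<in> T" for s \<theta>
    using that vars_subformulas[of _ _ Pos \<phi> s] by (fastforce simp: T_def avoids_def)
  then have "\<forall>s. vars s \<chi> \<subseteq> vars s \<phi> - P s"
    using vars_\<chi> by blast
  moreover have "\<phi> \<^bold>\<longrightarrow> \<chi> \<in> ?L"
    using eval_\<chi> by (auto simp: N_ext_iff_models)
  moreover have "\<chi> \<^bold>\<longrightarrow> \<psi> \<in> ?L"
    if \<psi>: "\<phi> \<^bold>\<longrightarrow> \<psi> \<in> ?L" "\<forall>s. vars s \<psi> \<inter> P s = {}" for \<psi>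
  proof -
    have "eval v b \<psi>" if M: "model ?L v b" and "eval v b \<chi>" for v b
    proof -
      obtain v1 b1 where M1: "model ?L v1 b1" "eval v1 b1 \<phi>"
        and T: "\<forall>\<theta>\<in>T. eval v1 b1 \<theta> \<longrightarrow> eval v b \<theta>"
        using \<open>eval v b \<chi>\<close> eval_\<chi> by blast
      \<comment> \<open>The disjunct of \<chi> that holds at \<open>(v, b)\<close> says exactly that
        permitted signed subformulas transfer from \<open>(v1, b1)\<close>.\<close>
      interpret amalgamation A R \<phi> P v1 v b1 b
        using M M1 T by unfold_locales (force simp: T_def)+
      \<comment> \<open>The theorem holds at the amalgam, where \<phi> is true; hence \<psi> is true
        there and, being permitted, passes to \<open>(v, b)\<close>.\<close>
      have "val (\<phi> \<^bold>\<longrightarrow> \<psi>)"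
        using A R \<psi>(1) by (rule model_val)
      then have "val \<psi>"
        using val_phi[OF M1(2)] by simp
      moreover have "avoids P Pos \<psi>"
        using \<psi>(2) by (simp add: avoids_def)
      ultimately show ?thesis
        using val_avoids by blast
    qed
    then show ?thesis
      by (simp add: N_ext_iff_models)
  qed
  ultimately show "\<exists>\<chi>. (\<forall>s. vars s \<chi> \<subseteq> vars s \<phi> - P s) \<and> \<phi> \<^bold>\<longrightarrow> \<chi> \<in> ?L \<and>
      (\<forall>\<psi>. \<phi> \<^bold>\<longrightarrow> \<psi> \<in> ?L \<and> (\<forall>s. vars s \<psi> \<inter> P s = {}) \<longrightarrow> \<chi> \<^bold>\<longrightarrow> \<psi> \<in> ?L)"
    by blast
qed

theorem corollary5p9:
  fixes m n :: nat and L :: "'v fm set"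
  assumes "countable (UNIV :: 'v set)" and "infinite (UNIV :: 'v set)"
    and "L \<in> {NA m n, NplusA m n, NRA m n}"
  shows "ULIP L"
proof -
  have Acc: "\<exists>\<theta> \<eta>. \<alpha> = \<theta> \<^bold>\<longrightarrow> \<eta> \<and> core \<theta> = core \<eta>" if "\<alpha> \<in> Acc m n" for \<alpha> :: "'v fm"
    using that by (auto simp: Acc_def)
  \<comment> \<open>In the rule of \<open>NplusA\<close> both \<theta> and \<eta> are the boxed
    formula of the premise; in that of \<open>NRA\<close> both are the formula refuted by the
    premise.\<close>
  have "ULIP (NA m n :: 'v fm set)" "ULIP (NplusA m n :: 'v fm set)" "ULIP (NRA m n :: 'v fm set)"
    unfolding NA_def NplusA_def NRA_def by (rule ULIP_N_ext[OF Acc]; auto)+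
  then show ?thesis
    using assms(3) by blast
qed

end
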